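(* Let $G=I_{2}(m)$ for a finite $m\ge2$, with Coxeter generators $s_1,s_2$, and let $b=s_1$, $a=s_1\cdot s_2$. Then the Coxeter length on $G$ is equidistributed with the length in the OGS canonical form with respect to $OGS(I_{2}(m))=\langle b, a\rangle$; that is, for every integer $k$, the number of elements of $G$ of Coxeter length $k$ equals the number of elements $g=b^{j}\cdot a^{i}$ (with $0\le j\le 1$, $0\le i\le m-1$) such that $j+i=k$.
   Context: $I_2(m)=\langle s_1,s_2\mid s_1^2=s_2^2=1,(s_1s_2)^m=1\rangle$. The Coxeter length of $g$ is the minimal number of letters from $\{s_1,s_2\}$ in a word representing $g$. Every element of $I_2(m)$ has a unique presentation $b^j a^i$ with $0\le j\le 1$, $0\le i\le m-1$ (its OGS canonical form with respect to $\langle b,a\rangle$), and the length in this form is the sum of the exponents $j+i$. *)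

theory Defs
  imports "HOL-Algebra.Group"
begin

section \<open>Groups given by generators and relators\<close>

text \<open>
  The generators are all elements of the type \<open>'a\<close>.  The letter \<open>(x, True)\<close> stands for the
  generator \<open>x\<close> and \<open>(x, False)\<close> for its formal inverse.
\<close>

type_synonym 'a gword = "('a \<times> bool) list"

inductive pres_cong :: "'a gword set \<Rightarrow> 'a gword \<Rightarrow> 'a gword \<Rightarrow> bool" for R where
  refl: "pres_cong R u u"
| sym: "pres_cong R u v \<Longrightarrow> pres_cong R v u"
| trans: "pres_cong R u v \<Longrightarrow> pres_cong R v w \<Longrightarrow> pres_cong R u w"
| cancel: "pres_cong R (u @ [(x, e), (x, \<not> e)] @ v) (u @ v)"
| relator: "r \<in> R \<Longrightarrow> pres_cong R (u @ r @ v) (u @ v)"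

definition pres_rel :: "'a gword set \<Rightarrow> ('a gword \<times> 'a gword) set" where
  "pres_rel R = {(u, v). pres_cong R u v}"

text \<open>
  The product of two classes is the class of the concatenation of any of their representatives;
  lemma \<open>presented_group_mult_class\<close> below confirms that the union over all
  representatives is that single class.
\<close>

definition presented_group :: "'a gword set \<Rightarrow> 'a gword set monoid" where
  "presented_group R =
     \<lparr>carrier = UNIV // pres_rel R,
      mult = (\<lambda>A B. pres_rel R `` {u @ v |u v. u \<in> A \<and> v \<in> B}),
      one = pres_rel R `` {[]}\<rparr>"

definition presented_gen :: "'a gword set \<Rightarrow> 'a \<Rightarrow> 'a gword set" where
  "presented_gen R x = pres_rel R `` {[(x, True)]}"

lemma equiv_pres_rel: "equiv UNIV (pres_rel R)"
  by (rule equivI)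
    (auto simp: pres_rel_def refl_on_def sym_def trans_def
      intro: pres_cong.refl pres_cong.sym pres_cong.trans)

lemma pres_cong_context: "pres_cong R u v \<Longrightarrow> pres_cong R (p @ u @ q) (p @ v @ q)"
proof (induction rule: pres_cong.induct)
  case (cancel u x e v)
  show ?case using pres_cong.cancel[of R "p @ u" x e "v @ q"] by simp
next
  case (relator r u v)
  then show ?case using pres_cong.relator[of r R "p @ u" "v @ q"] by simp
qed (auto intro: pres_cong.refl pres_cong.sym pres_cong.trans)

lemma pres_cong_append:
  assumes "pres_cong R u u'" "pres_cong R v v'"
  shows "pres_cong R (u @ v) (u' @ v')"
  using pres_cong_context[OF assms(1), of "[]" v] pres_cong_context[OF assms(2), of u' "[]"]
  by (auto intro: pres_cong.trans)

lemma presented_group_mult_class: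
  "pres_rel R `` {u} \<otimes>\<^bsub>presented_group R\<^esub> pres_rel R `` {v} = pres_rel R `` {u @ v}"
  unfolding presented_group_def pres_rel_def
  by (auto intro: pres_cong.refl pres_cong.trans pres_cong_append)

lemma group_presented_group: "group (presented_group R)"
proof (rule groupI)
  have cls: "x \<in> carrier (presented_group R) \<longleftrightarrow> (\<exists>u. x = pres_rel R `` {u})" for x
    by (auto simp: presented_group_def quotient_def)
  have one: "\<one>\<^bsub>presented_group R\<^esub> = pres_rel R `` {[]}"
    by (simp add: presented_group_def)
  have eq: "pres_cong R u v \<Longrightarrow> pres_rel R `` {u} = pres_rel R `` {v}" for u v
    by (rule equiv_class_eq[OF equiv_pres_rel]) (simp add: pres_rel_def)
  show "\<one>\<^bsub>presented_group R\<^esub> \<in> carrier (presented_group R)"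
    by (auto simp: cls one)
  fix x assume x: "x \<in> carrier (presented_group R)"
  then obtain u where u: "x = pres_rel R `` {u}" by (auto simp: cls)
  show "\<one>\<^bsub>presented_group R\<^esub> \<otimes>\<^bsub>presented_group R\<^esub> x = x"
    by (simp add: u one presented_group_mult_class)
  have "\<exists>v. pres_cong R (v @ u) []"
  proof (induction u)
    case Nil
    show ?case by (auto intro: pres_cong.refl)
  next
    case (Cons l u)
    then obtain v where v: "pres_cong R (v @ u) []" by blast
    obtain x e where l: "l = (x, e)" by (cases l)
    have "pres_cong R (v @ [(x, \<not> e), (x, \<not> \<not> e)] @ u) (v @ u)"
      by (rule pres_cong.cancel)
    then have "pres_cong R ((v @ [(x, \<not> e)]) @ l # u) []"
      using v by (auto simp: l intro: pres_cong.trans)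
    then show ?case by blast
  qed
  then obtain v where "pres_cong R (v @ u) []" by blast
  then show "\<exists>y\<in>carrier (presented_group R). y \<otimes>\<^bsub>presented_group R\<^esub> x = \<one>\<^bsub>presented_group R\<^esub>"
    by (intro bexI[of _ "pres_rel R `` {v}"])
      (auto simp: u one cls presented_group_mult_class eq)
  fix y assume "y \<in> carrier (presented_group R)"
  then obtain v where v: "y = pres_rel R `` {v}" by (auto simp: cls)
  show "x \<otimes>\<^bsub>presented_group R\<^esub> y \<in> carrier (presented_group R)"
    by (auto simp: u v cls presented_group_mult_class)
  fix z assume "z \<in> carrier (presented_group R)"
  then obtain w where "z = pres_rel R `` {w}" by (auto simp: cls)
  then show "x \<otimes>\<^bsub>presented_group R\<^esub> y \<otimes>\<^bsub>presented_group R\<^esub> z =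
      x \<otimes>\<^bsub>presented_group R\<^esub> (y \<otimes>\<^bsub>presented_group R\<^esub> z)"
    by (simp add: u v presented_group_mult_class)
qed

section \<open>The dihedral Coxeter group\<close>

datatype cox_gen = S1 | S2

definition I2_relators :: "nat \<Rightarrow> cox_gen gword set" where
  "I2_relators m =
     {[(S1, True), (S1, True)], [(S2, True), (S2, True)],
      concat (replicate m [(S1, True), (S2, True)])}"

definition I2 :: "nat \<Rightarrow> cox_gen gword set monoid" where
  "I2 m = presented_group (I2_relators m)"

definition s1 :: "nat \<Rightarrow> cox_gen gword set" where
  "s1 m = presented_gen (I2_relators m) S1"

definition s2 :: "nat \<Rightarrow> cox_gen gword set" where
  "s2 m = presented_gen (I2_relators m) S2"

definition word_length :: "('g, 'b) monoid_scheme \<Rightarrow> 'g set \<Rightarrow> 'g \<Rightarrow> nat" where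
  "word_length G S g =
     (LEAST n. \<exists>ws. set ws \<subseteq> S \<and> length ws = n \<and> foldr (\<otimes>\<^bsub>G\<^esub>) ws \<one>\<^bsub>G\<^esub> = g)"

definition coxeter_length :: "nat \<Rightarrow> cox_gen gword set \<Rightarrow> nat" where
  "coxeter_length m = word_length (I2 m) {s1 m, s2 m}"

end

theory Submission imports Defs begin

text \<open>
  The Cayley graph of \<open>I\<^sub>2(m)\<close> is a cycle of length \<open>2m\<close>, the elements being the chambers
  into which the \<open>m\<close> reflection lines cut the plane.  Label the chambers in cyclic order by the
  integers modulo \<open>2m\<close>, the identity getting the label \<open>0\<close>.  Left multiplication by the two generators is then reflection
  of the labels in the two walls of the chamber \<open>0\<close>, that is \<open>N \<mapsto> 1 - N\<close> and \<open>N \<mapsto> -1 - N\<close>.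

  Any group with two involutions \<open>s\<close>, \<open>t\<close> carries such labels, possibly with repetitions: the
  element \<open>chamber N\<close> is the alternating product of \<open>\<bar>N\<bar>\<close> letters that starts with \<open>s\<close> if \<open>N > 0\<close>
  and with \<open>t\<close> if \<open>N < 0\<close> (lemmas \<open>mult_s_chamber\<close>, \<open>mult_t_chamber\<close>).  A letter changes the
  absolute value of a label by one at most, so the word length of an element is the least
  absolute value of its labels (lemma \<open>word_length_chamber\<close>).  In \<open>I\<^sub>2(m)\<close> two labels give the
  same element exactly if they agree modulo \<open>2m\<close> (lemma \<open>chamber_eq_iff\<close>): the relator
  \<open>(s\<^sub>1s\<^sub>2)\<^sup>m\<close> translates labels by \<open>2m\<close>, and conversely the reflections of the labels respect all
  relators.  Hence every element has exactly one label in \<open>{1 - m..m}\<close>, and its Coxeter length is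
  the absolute value of that label.

  The canonical forms are parametrised by the same window: \<open>N \<le> 0\<close> stands for \<open>a\<close> to the power
  \<open>-N\<close> and \<open>N > 0\<close> for \<open>b\<close> times \<open>a\<close> to the power \<open>N - 1\<close>, and in both cases the sum of the
  exponents is \<open>\<bar>N\<bar>\<close>.  So both statistics are distributed like \<open>\<bar>N\<bar>\<close> on \<open>{1 - m..m}\<close>.
\<close>

section \<open>Groups with two distinguished involutions\<close>

locale two_involutions = group G for G (structure) +
  fixes s t
  assumes s_closed [simp]: "s \<in> carrier G" and t_closed [simp]: "t \<in> carrier G"
    and s_s: "s \<otimes> s = \<one>" and t_t: "t \<otimes> t = \<one>"
begin

text \<open>
  The alternating products have this closed form because \<open>t \<otimes> s\<close> is the inverse of \<open>s \<otimes> t\<close>: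
  those with an even number of letters are powers of \<open>s \<otimes> t\<close> with exponent of either sign, and
  those with an odd number are \<open>s\<close> times such a power.  Periodicity in \<open>N\<close> thus becomes a
  statement on powers of \<open>s \<otimes> t\<close>.
\<close>

definition chamber :: "int \<Rightarrow> 'a" where
  "chamber N = (if even N then (s \<otimes> t) [^] (N div 2) else s \<otimes> (s \<otimes> t) [^] (- (N div 2)))"

lemma chamber_even: "chamber (2 * i) = (s \<otimes> t) [^] i"
  by (simp add: chamber_def)

lemma chamber_odd: "chamber (1 - 2 * i) = s \<otimes> (s \<otimes> t) [^] i"
proof -
  have "(1 - 2 * i) div 2 = - i" by presburger
  then show ?thesis by (simp add: chamber_def)
qed

lemma chamber_closed [simp]: "chamber N \<in> carrier G"
  by (simp add: chamber_def)

lemma chamber_0 [simp]: "chamber 0 = \<one>"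
  by (simp add: chamber_def)

lemma label_cases:
  fixes N :: int
  obtains i where "N = 2 * i" | i where "N = 1 - 2 * i"
proof (cases "even N")
  case True
  then show ?thesis using that(1) by (auto elim: evenE)
next
  case False
  then have "N = 1 - 2 * (- (N div 2))" by presburger
  then show ?thesis by (rule that(2))
qed

lemma s_mult_s_mult: "x \<in> carrier G \<Longrightarrow> s \<otimes> (s \<otimes> x) = x"
  by (simp add: m_assoc [symmetric] s_s)

lemma t_mult_t_mult: "x \<in> carrier G \<Longrightarrow> t \<otimes> (t \<otimes> x) = x"
  by (simp add: m_assoc [symmetric] t_t)

lemma mult_s_chamber: "s \<otimes> chamber N = chamber (1 - N)"
proof (cases N rule: label_cases)
  case (1 i)
  then show ?thesis by (simp add: chamber_even chamber_odd)
next
  case (2 i)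
  then show ?thesis by (simp add: chamber_even chamber_odd s_mult_s_mult)
qed

lemma mult_t_chamber: "t \<otimes> chamber N = chamber (- 1 - N)"
proof -
  \<comment> \<open>Both cases come from \<open>t = s \<otimes> (s \<otimes> t)\<close>: in front of a power of \<open>s \<otimes> t\<close> it shifts the exponent.\<close>
  have st: "s \<otimes> t \<otimes> (s \<otimes> t) [^] i = (s \<otimes> t) [^] (i + 1)" for i :: int
    using int_pow_mult [of "s \<otimes> t" 1 i] by (simp add: int_pow_1 add.commute)
  have t: "t \<otimes> (s \<otimes> t) [^] i = s \<otimes> (s \<otimes> t) [^] (i + 1)" for i :: int
    by (simp add: st [symmetric] m_assoc s_mult_s_mult)
  show ?thesis
  proof (cases N rule: label_cases)
    case (1 i)
    have "- 1 - N = 1 - 2 * (i + 1)" using 1 by simp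
    then show ?thesis using 1 by (simp only: chamber_even chamber_odd t)
  next
    case (2 i)
    have "s \<otimes> (s \<otimes> t) [^] i = t \<otimes> (s \<otimes> t) [^] (i - 1)" by (simp add: t)
    then have "t \<otimes> chamber N = (s \<otimes> t) [^] (i - 1)"
      using 2 by (simp add: chamber_odd t_mult_t_mult)
    moreover have "- 1 - N = 2 * (i - 1)" using 2 by simp
    ultimately show ?thesis by (simp only: chamber_even)
  qed
qed

lemma chamber_periodic:
  assumes "(s \<otimes> t) [^] (m :: nat) = \<one>" and "2 * int m dvd N - N'"
  shows "chamber N = chamber N'"
proof -
  obtain q where q: "N = N' + 2 * (int m * q)"
    using assms(2) by (metis dvdE add.commute diff_add_cancel mult.assoc)
  have "(s \<otimes> t) [^] (int m * q) = \<one>" for q :: int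
    by (simp add: int_pow_pow [symmetric] int_pow_int assms(1))
  then have pow: "(s \<otimes> t) [^] (i + int m * q) = (s \<otimes> t) [^] i" for i q :: int
    by (simp add: int_pow_mult)
  show ?thesis
  proof (cases N' rule: label_cases)
    case (1 i)
    have "N = 2 * (i + int m * q)" using q 1 by simp
    then show ?thesis using 1 by (simp only: chamber_even pow)
  next
    case (2 i)
    have "N = 1 - 2 * (i + int m * (- q))" using q 2 by simp
    then show ?thesis using 2 by (simp only: chamber_odd pow)
  qed
qed

lemma word_chamber:
  assumes "set ws \<subseteq> {s, t}"
  shows "\<exists>N. \<bar>N\<bar> \<le> int (length ws) \<and> foldr (\<otimes>) ws \<one> = chamber N"
  using assms
proof (induction ws)
  case Nil
  show ?case by (intro exI [of _ 0]) simp
next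
  case (Cons w ws)
  then obtain N where N: "\<bar>N\<bar> \<le> int (length ws)" "foldr (\<otimes>) ws \<one> = chamber N" by auto
  from Cons.prems have "w = s \<or> w = t" by auto
  then show ?case
  proof
    assume "w = s"
    then show ?thesis using N by (intro exI [of _ "1 - N"]) (simp add: mult_s_chamber)
  next
    assume "w = t"
    then show ?thesis using N by (intro exI [of _ "- 1 - N"]) (simp add: mult_t_chamber)
  qed
qed

text \<open>
  Reflecting in the wall between the chambers \<open>0\<close> and \<open>1\<close> (if \<open>N > 0\<close>) or \<open>0\<close> and \<open>-1\<close>
  (if \<open>N < 0\<close>) brings the label one step closer to \<open>0\<close>, so that \<open>\<bar>N\<bar>\<close> reflections reach \<open>0\<close>.
\<close>

lemma chamber_word:
  "\<exists>ws. set ws \<subseteq> {s, t} \<and> length ws = n \<and> foldr (\<otimes>) ws \<one> = chamber N" if "\<bar>N\<bar> = int n"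
  using that
proof (induction n arbitrary: N)
  case 0
  then show ?case by simp
next
  case (Suc n)
  show ?case
  proof (cases "N > 0")
    case True
    with Suc.prems have "\<bar>1 - N\<bar> = int n" by simp
    from Suc.IH [OF this] obtain ws where
      "set ws \<subseteq> {s, t}" "length ws = n" "foldr (\<otimes>) ws \<one> = chamber (1 - N)" by blast
    then show ?thesis by (intro exI [of _ "s # ws"]) (simp add: mult_s_chamber)
  next
    case False
    with Suc.prems have "\<bar>- 1 - N\<bar> = int n" by simp
    from Suc.IH [OF this] obtain ws where
      "set ws \<subseteq> {s, t}" "length ws = n" "foldr (\<otimes>) ws \<one> = chamber (- 1 - N)" by blast
    then show ?thesis by (intro exI [of _ "t # ws"]) (simp add: mult_t_chamber)
  qed
qed

lemma word_length_chamber: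
  assumes "\<And>N'. chamber N' = chamber N \<Longrightarrow> \<bar>N\<bar> \<le> \<bar>N'\<bar>"
  shows "int (word_length G {s, t} (chamber N)) = \<bar>N\<bar>"
proof -
  have "word_length G {s, t} (chamber N) = nat \<bar>N\<bar>"
    unfolding word_length_def
  proof (rule Least_equality)
    show "\<exists>ws. set ws \<subseteq> {s, t} \<and> length ws = nat \<bar>N\<bar> \<and> foldr (\<otimes>) ws \<one> = chamber N"
      by (rule chamber_word) simp
  next
    fix n
    assume "\<exists>ws. set ws \<subseteq> {s, t} \<and> length ws = n \<and> foldr (\<otimes>) ws \<one> = chamber N"
    then obtain ws where "set ws \<subseteq> {s, t}" "length ws = n" "foldr (\<otimes>) ws \<one> = chamber N"
      by blast
    then show "nat \<bar>N\<bar> \<le> n"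
      using word_chamber [of ws] assms by fastforce
  qed
  then show ?thesis by simp
qed

end

section \<open>The reflection action of words on labels\<close>

fun reflect :: "cox_gen \<times> bool \<Rightarrow> int \<Rightarrow> int" where
  "reflect (S1, e) N = 1 - N"
| "reflect (S2, e) N = - 1 - N"

lemma reflect_reflect [simp]: "reflect (x, e) (reflect (x, e') N) = N"
  by (cases x) simp_all

lemma dvd_foldr_reflect:
  "d dvd N - N' \<Longrightarrow> d dvd foldr reflect w N - foldr reflect w N'"
proof (induction w)
  case (Cons l w)
  obtain x e where "l = (x, e)" by (cases l)
  then show ?case using Cons by (cases x) (simp_all add: dvd_diff_commute)
qed simp

text \<open>As in the proof of \<open>chamber_word\<close>, the reflections lead from \<open>M\<close> back to \<open>0\<close> step by step.\<close>

lemma reach_label: "\<exists>u. foldr reflect u 0 = M" if "\<bar>M\<bar> = int n"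
  using that
proof (induction n arbitrary: M)
  case 0
  then show ?case by (intro exI [of _ "[]"]) simp
next
  case (Suc n)
  show ?case
  proof (cases "M > 0")
    case True
    with Suc.prems have "\<bar>1 - M\<bar> = int n" by simp
    from Suc.IH [OF this] obtain u where "foldr reflect u 0 = 1 - M" ..
    then show ?thesis by (intro exI [of _ "(S1, True) # u"]) simp
  next
    case False
    with Suc.prems have "\<bar>- 1 - M\<bar> = int n" by simp
    from Suc.IH [OF this] obtain u where "foldr reflect u 0 = - 1 - M" ..
    then show ?thesis by (intro exI [of _ "(S2, True) # u"]) simp
  qed
qed

lemma foldr_reflect_rotation:
  "foldr reflect (concat (replicate m [(S1, True), (S2, True)])) N = N + 2 * int m"
  by (induction m) simp_all

text \<open>
  The letters act on the integers themselves; only the relator \<open>(s\<^sub>1s\<^sub>2)\<^sup>m\<close>, which acts as a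
  translation, forces the passage to labels modulo \<open>2m\<close>.  This is what keeps the presented group
  from being smaller than expected.
\<close>

lemma pres_cong_reflect:
  "pres_cong (I2_relators m) u v \<Longrightarrow> 2 * int m dvd foldr reflect u N - foldr reflect v N"
proof (induction arbitrary: N rule: pres_cong.induct)
  case (sym u v)
  then show ?case by (simp add: dvd_diff_commute)
next
  case (trans u v w)
  then show ?case using dvd_add [OF trans.IH(1) [of N] trans.IH(2) [of N]] by simp
next
  case (relator r u v)
  have "2 * int m dvd foldr reflect r M - M" for M
    using relator by (auto simp: I2_relators_def foldr_reflect_rotation)
  then show ?case by (simp add: dvd_foldr_reflect)
qed simp_all

section \<open>Chambers of the dihedral group\<close>

abbreviation word_class :: "nat \<Rightarrow> cox_gen gword \<Rightarrow> cox_gen gword set" where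
  "word_class m u \<equiv> pres_rel (I2_relators m) `` {u}"

lemma word_class_eq_iff: "word_class m u = word_class m v \<longleftrightarrow> pres_cong (I2_relators m) u v"
  using eq_equiv_class_iff [OF equiv_pres_rel, of u v "I2_relators m"] by (simp add: pres_rel_def)

lemma word_class_mult: "word_class m u \<otimes>\<^bsub>I2 m\<^esub> word_class m v = word_class m (u @ v)"
  unfolding I2_def by (rule presented_group_mult_class)

lemma one_I2: "\<one>\<^bsub>I2 m\<^esub> = word_class m []"
  by (simp add: I2_def presented_group_def)

lemma word_class_carrier: "word_class m u \<in> carrier (I2 m)"
  by (auto simp: I2_def presented_group_def quotient_def)

lemma word_class_relator: "r \<in> I2_relators m \<Longrightarrow> word_class m r = \<one>\<^bsub>I2 m\<^esub>"
  using pres_cong.relator [of r _ "[]" "[]"] by (simp add: one_I2 word_class_eq_iff)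

lemma relator_I2:
  "[(S1, True), (S1, True)] \<in> I2_relators m"
  "[(S2, True), (S2, True)] \<in> I2_relators m"
  "concat (replicate m [(S1, True), (S2, True)]) \<in> I2_relators m"
  by (simp_all add: I2_relators_def)

lemma group_I2: "group (I2 m)"
  unfolding I2_def by (rule group_presented_group)

lemma s1_class: "s1 m = word_class m [(S1, True)]"
  by (simp add: s1_def presented_gen_def)

lemma s2_class: "s2 m = word_class m [(S2, True)]"
  by (simp add: s2_def presented_gen_def)

interpretation I2: two_involutions "I2 m" "s1 m" "s2 m" for m
proof (intro two_involutions.intro two_involutions_axioms.intro)
  show "group (I2 m)" by (rule group_I2)
  show "s1 m \<otimes>\<^bsub>I2 m\<^esub> s1 m = \<one>\<^bsub>I2 m\<^esub>" "s2 m \<otimes>\<^bsub>I2 m\<^esub> s2 m = \<one>\<^bsub>I2 m\<^esub>"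
    using relator_I2(1,2) [THEN word_class_relator] by (simp_all add: s1_class s2_class word_class_mult)
qed (simp_all add: s1_class s2_class word_class_carrier)

lemma rotation_pow: "(s1 m \<otimes>\<^bsub>I2 m\<^esub> s2 m) [^]\<^bsub>I2 m\<^esub> m = \<one>\<^bsub>I2 m\<^esub>"
proof -
  have "(s1 m \<otimes>\<^bsub>I2 m\<^esub> s2 m) [^]\<^bsub>I2 m\<^esub> n
      = word_class m (concat (replicate n [(S1, True), (S2, True)]))" for n :: nat
  proof (induction n)
    case 0
    show ?case by (simp add: one_I2)
  next
    case (Suc n)
    have "(s1 m \<otimes>\<^bsub>I2 m\<^esub> s2 m) [^]\<^bsub>I2 m\<^esub> Suc n
        = (s1 m \<otimes>\<^bsub>I2 m\<^esub> s2 m) \<otimes>\<^bsub>I2 m\<^esub> (s1 m \<otimes>\<^bsub>I2 m\<^esub> s2 m) [^]\<^bsub>I2 m\<^esub> n"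
      by (rule I2.nat_pow_Suc2) simp
    then show ?case by (simp only: Suc) (simp add: s1_class s2_class word_class_mult)
  qed
  then show ?thesis by (simp only: word_class_relator [OF relator_I2(3)])
qed

text \<open>As the generators are involutions, a formal inverse represents the same element.\<close>

lemma word_class_letter: "word_class m [(x, e)] = (case x of S1 \<Rightarrow> s1 m | S2 \<Rightarrow> s2 m)"
proof -
  have "pres_cong (I2_relators m) [(x, False)] [(x, True)]"
  proof (rule pres_cong.trans)
    have "[(x, True), (x, True)] \<in> I2_relators m" by (cases x) (simp_all add: I2_relators_def)
    from pres_cong.sym [OF pres_cong.relator [OF this, of "[(x, False)]" "[]"]]
    show "pres_cong (I2_relators m) [(x, False)] [(x, False), (x, True), (x, True)]" by simp
    show "pres_cong (I2_relators m) [(x, False), (x, True), (x, True)] [(x, True)]"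
      using pres_cong.cancel [of _ "[]" x False "[(x, True)]"] by simp
  qed
  then have "word_class m [(x, e)] = word_class m [(x, True)]"
    by (cases e) (simp_all add: word_class_eq_iff)
  then show ?thesis by (cases x) (simp_all add: s1_class s2_class)
qed

lemma word_class_chamber: "word_class m u = I2.chamber m (foldr reflect u 0)"
proof (induction u)
  case Nil
  show ?case by (simp add: one_I2)
next
  case (Cons l u)
  obtain x e where l: "l = (x, e)" by (cases l)
  have "word_class m (l # u) = word_class m [(x, e)] \<otimes>\<^bsub>I2 m\<^esub> word_class m u"
    by (simp add: word_class_mult l)
  then show ?case
    by (cases x) (simp_all add: Cons word_class_letter l I2.mult_s_chamber I2.mult_t_chamber)
qed

text \<open>
  The labels of an element can be read off, modulo \<open>2m\<close>, from any word for it: every label \<open>N\<close>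
  is the image of \<open>0\<close> under some word, which then represents \<open>chamber N\<close>, and words for the same
  element move \<open>0\<close> to congruent labels.
\<close>

lemma chamber_eq_iff: "I2.chamber m N = I2.chamber m N' \<longleftrightarrow> 2 * int m dvd N - N'"
proof
  assume eq: "I2.chamber m N = I2.chamber m N'"
  obtain u v where "foldr reflect u 0 = N" "foldr reflect v 0 = N'"
    using reach_label [of N "nat \<bar>N\<bar>"] reach_label [of N' "nat \<bar>N'\<bar>"] by auto
  moreover from this eq have "word_class m u = word_class m v"
    by (simp add: word_class_chamber)
  ultimately show "2 * int m dvd N - N'"
    using pres_cong_reflect [of m u v 0] by (simp add: word_class_eq_iff)
qed (rule I2.chamber_periodic [OF rotation_pow])

lemma inj_on_chamber: "inj_on (I2.chamber m) {1 - int m..int m}"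
proof (rule inj_onI)
  fix N N' assume N: "N \<in> {1 - int m..int m}" "N' \<in> {1 - int m..int m}"
    and "I2.chamber m N = I2.chamber m N'"
  then have "2 * int m dvd N - N'" by (simp add: chamber_eq_iff)
  moreover have "\<bar>N - N'\<bar> < 2 * int m" using N by auto
  ultimately show "N = N'" using dvd_imp_le_int [of "N - N'" "2 * int m"] by auto
qed

lemma carrier_I2:
  assumes "m > 0"
  shows "carrier (I2 m) = I2.chamber m ` {1 - int m..int m}"
proof (intro equalityI subsetI)
  fix g assume "g \<in> carrier (I2 m)"
  then obtain u where "g = word_class m u"
    by (auto simp: I2_def presented_group_def quotient_def)
  then obtain M where g: "g = I2.chamber m M" by (simp add: word_class_chamber)
  \<comment> \<open>The shift by \<open>m - 1\<close> moves the window \<open>{1 - m..m}\<close> to the standard residues \<open>{0..<2m}\<close>.\<close>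
  define N where "N = (M + int m - 1) mod (2 * int m) - int m + 1"
  have "2 * int m dvd (M + int m - 1) - (M + int m - 1) mod (2 * int m)"
    by (rule dvd_minus_mod)
  then have "2 * int m dvd M - N" by (simp add: N_def algebra_simps)
  moreover have "N \<in> {1 - int m..int m}"
    using assms pos_mod_bound [of "2 * int m" "M + int m - 1"]
      pos_mod_sign [of "2 * int m" "M + int m - 1"]
    unfolding N_def atLeastAtMost_iff by linarith
  ultimately show "g \<in> I2.chamber m ` {1 - int m..int m}"
    unfolding g by (metis chamber_eq_iff image_eqI)
qed auto

lemma coxeter_length_chamber:
  assumes "N \<in> {1 - int m..int m}"
  shows "int (coxeter_length m (I2.chamber m N)) = \<bar>N\<bar>"
  unfolding coxeter_length_def
proof (rule I2.word_length_chamber)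
  fix N' assume "I2.chamber m N' = I2.chamber m N"
  then have dvd: "2 * int m dvd N' - N" by (simp add: chamber_eq_iff)
  show "\<bar>N\<bar> \<le> \<bar>N'\<bar>"
  proof (cases "N' = N")
    case False
    with dvd have "2 * int m \<le> \<bar>N' - N\<bar>" using dvd_imp_le_int [of "N' - N" "2 * int m"] by simp
    then show ?thesis using assms by auto
  qed simp
qed

section \<open>Canonical forms and equidistribution\<close>

text \<open>
  The label of the canonical form that is indexed by \<open>N\<close>: that of \<open>a\<close> to the power \<open>-N\<close> is
  \<open>-2N\<close>, and that of \<open>b\<close> times \<open>a\<close> to the power \<open>N - 1\<close> is \<open>1 - 2(N - 1)\<close>.
\<close>

definition ogs_label :: "int \<Rightarrow> int" where
  "ogs_label N = (if N \<le> 0 then - 2 * N else 3 - 2 * N)"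

lemma inj_on_chamber_ogs_label: "inj_on (\<lambda>N. I2.chamber m (ogs_label N)) {1 - int m..int m}"
proof (rule inj_onI)
  fix N N' assume N: "N \<in> {1 - int m..int m}" "N' \<in> {1 - int m..int m}"
    and "I2.chamber m (ogs_label N) = I2.chamber m (ogs_label N')"
  then have dvd: "2 * int m dvd ogs_label N - ogs_label N'" by (simp add: chamber_eq_iff)
  \<comment> \<open>The parity of the label tells the powers of \<open>a\<close> from the reflections.\<close>
  then have "even (ogs_label N - ogs_label N')" by (rule dvd_trans [rotated]) simp
  then have sgn: "N \<le> 0 \<longleftrightarrow> N' \<le> 0" by (auto simp: ogs_label_def split: if_splits)
  then have "ogs_label N - ogs_label N' = 2 * (N' - N)" by (simp add: ogs_label_def)
  with dvd have "2 * int m dvd 2 * (N' - N)" by (simp only:)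
  then have "int m dvd N' - N" by (simp only: dvd_times_left_cancel_iff)
  moreover have "\<bar>N' - N\<bar> < int m" using N sgn by auto
  ultimately show "N = N'" using dvd_imp_le_int [of "N' - N" "int m"] by auto
qed

lemma ogs_elements:
  assumes "m > 0" and "b = s1 m" and "a = s1 m \<otimes>\<^bsub>I2 m\<^esub> s2 m"
  shows "{g \<in> carrier (I2 m). \<exists>j i :: nat. j \<le> 1 \<and> i \<le> m - 1 \<and>
            g = b [^]\<^bsub>I2 m\<^esub> j \<otimes>\<^bsub>I2 m\<^esub> a [^]\<^bsub>I2 m\<^esub> i \<and> int (j + i) = k}
       = (\<lambda>N. I2.chamber m (ogs_label N)) ` {N \<in> {1 - int m..int m}. \<bar>N\<bar> = k}"
    (is "?A = ?f ` ?W")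
proof -
  have rotation: "b [^]\<^bsub>I2 m\<^esub> (0 :: nat) \<otimes>\<^bsub>I2 m\<^esub> a [^]\<^bsub>I2 m\<^esub> i = ?f (- int i)" for i :: nat
    using I2.chamber_even [of m "int i"] assms(2,3) by (simp add: ogs_label_def int_pow_int)
  have reflection: "b [^]\<^bsub>I2 m\<^esub> (1 :: nat) \<otimes>\<^bsub>I2 m\<^esub> a [^]\<^bsub>I2 m\<^esub> i = ?f (int i + 1)" for i :: nat
    using I2.chamber_odd [of m "int i"] assms(2,3) by (simp add: ogs_label_def int_pow_int)
  show ?thesis
  proof (intro equalityI subsetI)
    fix g assume "g \<in> ?A"
    then obtain j i :: nat where ji: "j \<le> 1" "i \<le> m - 1" "int (j + i) = k"
      and g: "g = b [^]\<^bsub>I2 m\<^esub> j \<otimes>\<^bsub>I2 m\<^esub> a [^]\<^bsub>I2 m\<^esub> i" by auto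
    have "j = 0 \<or> j = 1" using ji(1) by auto
    then show "g \<in> ?f ` ?W"
    proof
      assume j: "j = 0"
      have "- int i \<in> ?W" using ji j assms(1) by auto
      moreover have "g = ?f (- int i)" using rotation [of i] g j by simp
      ultimately show ?thesis by blast
    next
      assume j: "j = 1"
      have "int i + 1 \<in> ?W" using ji j assms(1) by auto
      moreover have "g = ?f (int i + 1)" using reflection [of i] g j by (simp only:)
      ultimately show ?thesis by blast
    qed
  next
    fix g assume "g \<in> ?f ` ?W"
    then obtain N where N: "N \<in> ?W" and g: "g = ?f N" by blast
    have "\<exists>j i :: nat. j \<le> 1 \<and> i \<le> m - 1 \<and>
        g = b [^]\<^bsub>I2 m\<^esub> j \<otimes>\<^bsub>I2 m\<^esub> a [^]\<^bsub>I2 m\<^esub> i \<and> int (j + i) = k"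
    proof (cases "N \<le> 0")
      case True
      then have "g = b [^]\<^bsub>I2 m\<^esub> (0 :: nat) \<otimes>\<^bsub>I2 m\<^esub> a [^]\<^bsub>I2 m\<^esub> nat (- N)"
        unfolding rotation g by simp
      moreover have "nat (- N) \<le> m - 1" "int (0 + nat (- N)) = k" using N True by auto
      ultimately show ?thesis by (intro exI [of _ 0] exI [of _ "nat (- N)"]) simp
    next
      case False
      then have "g = b [^]\<^bsub>I2 m\<^esub> (1 :: nat) \<otimes>\<^bsub>I2 m\<^esub> a [^]\<^bsub>I2 m\<^esub> nat (N - 1)"
        unfolding reflection g by simp
      moreover have "nat (N - 1) \<le> m - 1" "int (1 + nat (N - 1)) = k" using N False by auto
      ultimately show ?thesis by (intro exI [of _ 1] exI [of _ "nat (N - 1)"]) simp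
    qed
    moreover have "g \<in> carrier (I2 m)" by (simp add: g)
    ultimately show "g \<in> ?A" by blast
  qed
qed

theorem proposition2p6:
  fixes m :: nat and k :: int and a b :: "cox_gen gword set"
  assumes "m \<ge> 2"
    and "b = s1 m"
    and "a = s1 m \<otimes>\<^bsub>I2 m\<^esub> s2 m"
  shows "card {g \<in> carrier (I2 m). int (coxeter_length m g) = k} =
         card {g \<in> carrier (I2 m). \<exists>j i :: nat. j \<le> 1 \<and> i \<le> m - 1 \<and>
                 g = b [^]\<^bsub>I2 m\<^esub> j \<otimes>\<^bsub>I2 m\<^esub> a [^]\<^bsub>I2 m\<^esub> i \<and> int (j + i) = k}"
    (is "card ?L = card ?R")
proof -
  define W where "W = {N \<in> {1 - int m..int m}. \<bar>N\<bar> = k}"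
  have W: "W \<subseteq> {1 - int m..int m}" by (auto simp: W_def)
  have m: "m > 0" using assms(1) by simp
  have "?L = I2.chamber m ` W"
    unfolding carrier_I2 [OF m] W_def by (auto simp: coxeter_length_chamber)
  then have "card ?L = card W"
    using card_image [OF inj_on_subset [OF inj_on_chamber W]] by simp
  also have "\<dots> = card ((\<lambda>N. I2.chamber m (ogs_label N)) ` W)"
    using card_image [OF inj_on_subset [OF inj_on_chamber_ogs_label W]] by simp
  also have "\<dots> = card ?R"
    unfolding W_def ogs_elements [OF m assms(2,3)] ..
  finally show ?thesis .
qed

end
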